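(* Let $L$ be a noetherian involutive division on $\mathbb{M}$ and $\succ$ an admissible monomial ordering. Then any polynomial ideal $Id(F)$, $F\subset R$ finite, has a finite $L$-involutive basis; that is, there is a finite $L$-autoreduced set $G\subset R$ with $Id(G)=Id(F)$ and $NF_L(gu,G)=0$ for all $g\in G$ and all $u\in\mathbb{M}$.
   Context: $R=K[x_1,\dots,x_n]$ with $K$ a field of characteristic zero; $\mathbb{M}$ is the monoid of monomials; $Id(F)$ is the ideal of $R$ generated by $F$. $\succ$ is an admissible monomial ordering with $x_1\succ\cdots\succ x_n$; $lt(f)$, $lc(f)$, $lm(f)=lt(f)/lc(f)$ are the leading term, leading coefficient and leading monomial of $f$; $lm(G)=\{lm(g)\mid g\in G\}$. Involutive division: $L$ is given if for any finite $U\subset\mathbb{M}$ and any $u\in U$ there is given a submonoid $L(u,U)$ of $\mathbb{M}$ such that (a) if $w\in L(u,U)$ and $v\mid w$, then $v\in L(u,U)$; (b) if $u,v\in U$ and $uL(u,U)\cap vL(v,U)\ne\emptyset$, then $u\in vL(v,U)$ or $v\in uL(u,U)$; (c) if $v\in U$ and $v\in uL(u,U)$, then $L(v,U)\subseteq L(u,U)$; (d) if $V\subseteq U$, then $L(u,U)\subseteq L(u,V)$ for all $u\in V$. For $u\in U$, $u|_L w$ means $w\in uL(u,U)$. The cone of $U$ is $C(U)=\bigcup_{u\in U}u\,\mathbb{M}$, and the involutive cone is $C_L(U)=\bigcup_{u\in U}uL(u,U)$. $U$ is $L$-involutive if $C(U)=C_L(U)$. $U$ is $L$-autoreduced if no element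 of $U$ is $L$-divisible (w.r.t. $U$) by another element of $U$. Noetherity: $L$ is noetherian if for every finite $U\subset\mathbb{M}$ there is a finite $L$-involutive set $\tilde U\supseteq U$ with $C(\tilde U)=C(U)$. $L$-autoreduced polynomial set: a finite set $G$ of nonzero polynomials with pairwise distinct leading monomials such that $lm(G)$ is $L$-autoreduced and no $g\in G$ has a term with nonzero coefficient, other than $lt(g)$, whose monomial lies in $C_L(lm(G))$. Involutive reduction: $p$ is $L$-reducible modulo $g\in G$ if $p$ has a term $a\,u$ ($a\in K$, $a\neq0$, $u\in\mathbb{M}$) with $u=lm(g)v$, $v\in L(lm(g),lm(G))$; the corresponding $L$-reduction is $p\to p-(a/lc(g))\,g v$. $p$ is in $L$-normal form modulo $G$ if it is not $L$-reducible modulo any $g\in G$. $NF_L(p,G)$ denotes an $L$-normal form of $p$ modulo $G$, i.e. a polynomial in $L$-normal form modulo $G$ obtained from $p$ by a finite chain of $L$-reductions modulo $G$, chosen by an arbitrary fixed algorithm. *)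

theory Defs
  imports Complex_Main "HOL-Library.Poly_Mapping"
begin

(* The variables x_1, ..., x_n are indexed by a finite linearly ordered type 'x with
   n = CARD('x); smaller indices correspond to earlier variables.  Monomials are exponent
   vectors, so the monoid of monomials is written additively: the product of monomials is +
   and the monomial 1 is 0.  Polynomials in K[x_1, ..., x_n] are finitely supported
   functions from monomials to K, with the convolution product of Poly_Mapping. *)
type_synonym 'x monomial = "'x \<Rightarrow>\<^sub>0 nat"
type_synonym ('x, 'k) mpolynomial = "'x monomial \<Rightarrow>\<^sub>0 'k"

(* L u U is the set of L-multipliers of u with respect to U; its values are
   relevant only for finite U and u \<in> U. *)
type_synonym 'x division = "'x monomial \<Rightarrow> 'x monomial set \<Rightarrow> 'x monomial set"

definition mon_dvd :: "'x monomial \<Rightarrow> 'x monomial \<Rightarrow> bool" where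
  "mon_dvd v w \<longleftrightarrow> (\<exists>t. w = v + t)"

definition mon_submonoid :: "'x monomial set \<Rightarrow> bool" where
  "mon_submonoid S \<longleftrightarrow> 0 \<in> S \<and> (\<forall>u\<in>S. \<forall>v\<in>S. u + v \<in> S)"

text \<open>The set \<open>u L(u,U)\<close>; \<open>w\<close> belongs to it iff \<open>u\<close> is an \<open>L\<close>-divisor of \<open>w\<close> with respect to \<open>U\<close>.\<close>
definition inv_multiples :: "'x division \<Rightarrow> 'x monomial \<Rightarrow> 'x monomial set \<Rightarrow> 'x monomial set" where
  "inv_multiples L u U = {u + v | v. v \<in> L u U}"

definition involutive_division :: "'x division \<Rightarrow> bool" where
  "involutive_division L \<longleftrightarrow>
     (\<forall>U. finite U \<longrightarrow>
        (\<forall>u\<in>U. mon_submonoid (L u U)) \<and>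
        (\<forall>u\<in>U. \<forall>w\<in>L u U. \<forall>v. mon_dvd v w \<longrightarrow> v \<in> L u U) \<and>
        (\<forall>u\<in>U. \<forall>v\<in>U. inv_multiples L u U \<inter> inv_multiples L v U \<noteq> {} \<longrightarrow>
           u \<in> inv_multiples L v U \<or> v \<in> inv_multiples L u U) \<and>
        (\<forall>u\<in>U. \<forall>v\<in>U. v \<in> inv_multiples L u U \<longrightarrow> L v U \<subseteq> L u U) \<and>
        (\<forall>V. V \<subseteq> U \<longrightarrow> (\<forall>u\<in>V. L u U \<subseteq> L u V)))"

definition cone :: "'x monomial set \<Rightarrow> 'x monomial set" where
  "cone U = (\<Union>u\<in>U. {u + v | v. True})"

definition involutive_cone :: "'x division \<Rightarrow> 'x monomial set \<Rightarrow> 'x monomial set" where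
  "involutive_cone L U = (\<Union>u\<in>U. inv_multiples L u U)"

definition involutive_set :: "'x division \<Rightarrow> 'x monomial set \<Rightarrow> bool" where
  "involutive_set L U \<longleftrightarrow> cone U = involutive_cone L U"

definition autoreduced_monomials :: "'x division \<Rightarrow> 'x monomial set \<Rightarrow> bool" where
  "autoreduced_monomials L U \<longleftrightarrow> (\<forall>u\<in>U. \<forall>v\<in>U. v \<noteq> u \<longrightarrow> u \<notin> inv_multiples L v U)"

definition noetherian_division :: "'x division \<Rightarrow> bool" where
  "noetherian_division L \<longleftrightarrow>
     (\<forall>U. finite U \<longrightarrow>
        (\<exists>V. finite V \<and> U \<subseteq> V \<and> involutive_set L V \<and> cone V = cone U))"

(* gt u v is the strict relation "u is greater than v".  Well-foundedness is not part of the
   definition; it follows from these conditions by Dickson's lemma. *)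
definition admissible_order :: "('x monomial \<Rightarrow> 'x monomial \<Rightarrow> bool) \<Rightarrow> bool" where
  "admissible_order gt \<longleftrightarrow>
     (\<forall>u. \<not> gt u u) \<and>
     (\<forall>u v w. gt u v \<longrightarrow> gt v w \<longrightarrow> gt u w) \<and>
     (\<forall>u v. u \<noteq> v \<longrightarrow> gt u v \<or> gt v u) \<and>
     (\<forall>u. u \<noteq> 0 \<longrightarrow> gt u 0) \<and>
     (\<forall>u v w. gt u v \<longrightarrow> gt (u + w) (v + w))"

definition var :: "'x \<Rightarrow> 'x monomial" where
  "var i = Poly_Mapping.single i 1"

definition mon_poly :: "'x monomial \<Rightarrow> ('x, 'k::field_char_0) mpolynomial" where
  "mon_poly u = Poly_Mapping.single u 1"

(* lm and lc are meaningful for nonzero polynomials only. *)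
definition lm :: "('x monomial \<Rightarrow> 'x monomial \<Rightarrow> bool) \<Rightarrow> ('x, 'k::field_char_0) mpolynomial \<Rightarrow> 'x monomial" where
  "lm gt p = (THE u. u \<in> Poly_Mapping.keys p \<and> (\<forall>v\<in>Poly_Mapping.keys p. v \<noteq> u \<longrightarrow> gt u v))"

definition lc :: "('x monomial \<Rightarrow> 'x monomial \<Rightarrow> bool) \<Rightarrow> ('x, 'k::field_char_0) mpolynomial \<Rightarrow> 'k" where
  "lc gt p = Poly_Mapping.lookup p (lm gt p)"

(* The ideal generated by F is the span of F in the polynomial ring viewed as a module over itself. *)
definition ideal_gen :: "('x, 'k::field_char_0) mpolynomial set \<Rightarrow> ('x, 'k) mpolynomial set" where
  "ideal_gen F = module.span (*) F"

definition autoreduced ::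
  "'x division \<Rightarrow> ('x monomial \<Rightarrow> 'x monomial \<Rightarrow> bool) \<Rightarrow> ('x, 'k::field_char_0) mpolynomial set \<Rightarrow> bool" where
  "autoreduced L gt G \<longleftrightarrow>
     finite G \<and> 0 \<notin> G \<and> inj_on (lm gt) G \<and>
     autoreduced_monomials L (lm gt ` G) \<and>
     (\<forall>g\<in>G. \<forall>u\<in>Poly_Mapping.keys g. u \<noteq> lm gt g \<longrightarrow> u \<notin> involutive_cone L (lm gt ` G))"

text \<open>\<open>p\<close> \<open>L\<close>-reduces to \<open>q\<close> modulo the element \<open>g\<close> of \<open>G\<close>, by eliminating the term of \<open>p\<close> with monomial \<open>lm(g) v\<close>.\<close>
definition red_step ::
  "'x division \<Rightarrow> ('x monomial \<Rightarrow> 'x monomial \<Rightarrow> bool) \<Rightarrow> ('x, 'k::field_char_0) mpolynomial set \<Rightarrow>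
     ('x, 'k) mpolynomial \<Rightarrow> ('x, 'k) mpolynomial \<Rightarrow> ('x, 'k) mpolynomial \<Rightarrow> bool" where
  "red_step L gt G g p q \<longleftrightarrow>
     (\<exists>u v. u \<in> Poly_Mapping.keys p \<and> u = lm gt g + v \<and> v \<in> L (lm gt g) (lm gt ` G) \<and>
        q = p - Poly_Mapping.single 0 (Poly_Mapping.lookup p u / lc gt g) * (g * mon_poly v))"

definition reducible ::
  "'x division \<Rightarrow> ('x monomial \<Rightarrow> 'x monomial \<Rightarrow> bool) \<Rightarrow> ('x, 'k::field_char_0) mpolynomial set \<Rightarrow>
     ('x, 'k) mpolynomial \<Rightarrow> ('x, 'k) mpolynomial \<Rightarrow> bool" where
  "reducible L gt G g p \<longleftrightarrow>
     (\<exists>u v. u \<in> Poly_Mapping.keys p \<and> u = lm gt g + v \<and> v \<in> L (lm gt g) (lm gt ` G))"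

definition in_normal_form ::
  "'x division \<Rightarrow> ('x monomial \<Rightarrow> 'x monomial \<Rightarrow> bool) \<Rightarrow> ('x, 'k::field_char_0) mpolynomial set \<Rightarrow>
     ('x, 'k) mpolynomial \<Rightarrow> bool" where
  "in_normal_form L gt G p \<longleftrightarrow> (\<forall>g\<in>G. \<not> reducible L gt G g p)"

definition normal_form_of ::
  "'x division \<Rightarrow> ('x monomial \<Rightarrow> 'x monomial \<Rightarrow> bool) \<Rightarrow> ('x, 'k::field_char_0) mpolynomial set \<Rightarrow>
     ('x, 'k) mpolynomial \<Rightarrow> ('x, 'k) mpolynomial \<Rightarrow> bool" where
  "normal_form_of L gt G p h \<longleftrightarrow>
     (\<lambda>p q. \<exists>g\<in>G. red_step L gt G g p q)\<^sup>*\<^sup>* p h \<and> in_normal_form L gt G h"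

(* NF is an arbitrary fixed way of choosing a normal form NF p G of p modulo G.  The existence
   premise always holds for an involutive division and an admissible order; including it makes
   the predicate satisfiable without appeal to that fact, so that termination of reduction is
   not hidden in an assumption on NF. *)
definition normal_form_algorithm ::
  "'x division \<Rightarrow> ('x monomial \<Rightarrow> 'x monomial \<Rightarrow> bool) \<Rightarrow>
     (('x, 'k::field_char_0) mpolynomial \<Rightarrow> ('x, 'k) mpolynomial set \<Rightarrow> ('x, 'k) mpolynomial) \<Rightarrow> bool" where
  "normal_form_algorithm L gt NF \<longleftrightarrow>
     (\<forall>p G. finite G \<and> 0 \<notin> G \<and> (\<exists>h. normal_form_of L gt G p h) \<longrightarrow>
        normal_form_of L gt G p (NF p G))"

definition involutive_basis ::
  "'x division \<Rightarrow> ('x monomial \<Rightarrow> 'x monomial \<Rightarrow> bool) \<Rightarrow>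
     (('x, 'k::field_char_0) mpolynomial \<Rightarrow> ('x, 'k) mpolynomial set \<Rightarrow> ('x, 'k) mpolynomial) \<Rightarrow>
     ('x, 'k) mpolynomial set \<Rightarrow> ('x, 'k) mpolynomial set \<Rightarrow> bool" where
  "involutive_basis L gt NF I G \<longleftrightarrow>
     finite G \<and> autoreduced L gt G \<and> ideal_gen G = I \<and>
     (\<forall>g\<in>G. \<forall>u. NF (g * mon_poly u) G = 0)"

end

theory Submission
  imports Defs
begin

text \<open>
  The basis is read off from the monomial ideal \<open>M\<close> of leading monomials of \<open>I = Id(F)\<close>, so that no
  completion algorithm has to be shown to terminate. Dickson's lemma gives a finite set of
  monomials generating \<open>M\<close>, and noetherity enlarges it to a finite \<open>L\<close>-involutive set \<open>V\<close> with cone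
  \<open>M\<close>. An \<open>L\<close>-involutive subset \<open>W\<close> of \<open>V\<close> with the same cone and of least cardinality is \<open>L\<close>-autoreduced:
  if \<open>u\<close> were \<open>L\<close>-divisible by another element \<open>v\<close>, axiom (c) would place \<open>u L(u,W)\<close> inside
  \<open>v L(v,W)\<close>, and axiom (d) says that deleting \<open>u\<close> does not shrink the sets of multipliers of the
  remaining elements, so \<open>u\<close> could be deleted (\<open>autoreduced_involutive_subset\<close>).

  Every \<open>w \<in> W\<close> is the leading monomial of some \<open>g \<in> I\<close> all of whose other monomials avoid \<open>M\<close>,
  namely \<open>w\<close> minus its remainder modulo \<open>I\<close> (\<open>monomial_remainder\<close>). Since the involutive cone of \<open>W\<close>
  is \<open>M\<close>, these polynomials form an \<open>L\<close>-autoreduced set \<open>G\<close>. A nonzero element of \<open>I\<close> has its leading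
  monomial in \<open>M\<close>, hence can be reduced at that monomial. One consequence is that the only element of
  \<open>I\<close> in \<open>L\<close>-normal form is 0; the other, by well-foundedness of the ordering, is that every element
  of \<open>I\<close> reduces to 0, which shows both that \<open>G\<close> generates \<open>I\<close> and that normal forms exist.
\<close>

abbreviation "lookup \<equiv> Poly_Mapping.lookup"
abbreviation "keys \<equiv> Poly_Mapping.keys"

section \<open>Dickson's lemma\<close>

text \<open>
  The variables are treated one at a time: an infinite sequence of natural numbers has a
  nondecreasing subsequence, and passing to a further subsequence keeps the coordinates that were
  treated before nondecreasing.
\<close>
lemma nondecreasing_subsequence:
  fixes f :: "nat \<Rightarrow> 'x \<Rightarrow> nat"
  assumes "finite X"
  shows "\<exists>r :: nat \<Rightarrow> nat. strict_mono r \<and> (\<forall>x\<in>X. \<forall>i j. i \<le> j \<longrightarrow> f (r i) x \<le> f (r j) x)"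
  using assms
proof (induction X rule: finite_induct)
  case empty
  show ?case by (intro exI[of _ id]) (auto simp: strict_mono_def)
next
  case (insert x X)
  then obtain r :: "nat \<Rightarrow> nat" where r: "strict_mono r" "\<forall>x\<in>X. \<forall>i j. i \<le> j \<longrightarrow> f (r i) x \<le> f (r j) x"
    by blast
  obtain s :: "nat \<Rightarrow> nat" where s: "strict_mono s" "monoseq (\<lambda>n. f (r (s n)) x)"
    using seq_monosub[of "\<lambda>n. f (r n) x"] by blast
  have "\<exists>k. \<forall>i j. k \<le> i \<longrightarrow> i \<le> j \<longrightarrow> f (r (s i)) x \<le> f (r (s j)) x"
  proof (cases "\<forall>i j. i \<le> j \<longrightarrow> f (r (s i)) x \<le> f (r (s j)) x")
    case False
    with s(2) have dec: "f (r (s j)) x \<le> f (r (s i)) x" if "i \<le> j" for i j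
      using that unfolding monoseq_def by blast
    \<comment> \<open>A nonincreasing sequence is constant from any index on at which it attains its minimum.\<close>
    obtain k where "\<And>j. f (r (s k)) x \<le> f (r (s j)) x"
      using ex_has_least_nat[of "\<lambda>_. True" 0 "\<lambda>n. f (r (s n)) x"] by blast
    with dec show ?thesis by (meson order_trans)
  qed blast
  then obtain k where k: "\<And>i j. k \<le> i \<Longrightarrow> i \<le> j \<Longrightarrow> f (r (s i)) x \<le> f (r (s j)) x"
    by blast
  show ?case
  proof (intro exI conjI ballI allI impI)
    show "strict_mono (\<lambda>n. r (s (k + n)))"
      using r(1) s(1) by (simp add: strict_mono_def)
    fix y and i j :: nat
    assume y: "y \<in> insert x X" and "i \<le> j"
    then have "s (k + i) \<le> s (k + j)"
      using s(1) by (simp add: strict_mono_less_eq)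
    with y r(2) k \<open>i \<le> j\<close> show "f (r (s (k + i))) y \<le> f (r (s (k + j))) y"
      by auto
  qed
qed

lemma mon_dvd_iff_le: "mon_dvd u v \<longleftrightarrow> (\<forall>x. lookup u x \<le> lookup v x)"
proof
  assume "mon_dvd u v"
  then show "\<forall>x. lookup u x \<le> lookup v x"
    by (auto simp: mon_dvd_def lookup_add)
next
  assume "\<forall>x. lookup u x \<le> lookup v x"
  then have "v = u + (v - u)"
    by (intro poly_mapping_eqI) (simp add: lookup_add lookup_minus)
  then show "mon_dvd u v"
    unfolding mon_dvd_def by blast
qed

lemma ex_mon_dvd_in_sequence:
  fixes f :: "nat \<Rightarrow> 'x::finite monomial"
  shows "\<exists>i j. i < j \<and> mon_dvd (f i) (f j)"
proof -
  obtain r :: "nat \<Rightarrow> nat" where r: "strict_mono r"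
    "\<forall>x\<in>UNIV. \<forall>i j. i \<le> j \<longrightarrow> lookup (f (r i)) x \<le> lookup (f (r j)) x"
    using nondecreasing_subsequence[of UNIV "\<lambda>n. lookup (f n)"] by auto
  have "mon_dvd (f (r 0)) (f (r 1))" using r(2) by (simp add: mon_dvd_iff_le)
  moreover have "r 0 < r 1" using r(1) by (simp add: strict_mono_def)
  ultimately show ?thesis by blast
qed

lemma in_cone_iff: "w \<in> cone U \<longleftrightarrow> (\<exists>u\<in>U. mon_dvd u w)"
  by (auto simp: cone_def mon_dvd_def)

text \<open>
  The elements of \<open>S\<close> that are minimal for divisibility form an antichain, which is finite because
  no infinite sequence of monomials is free of divisibilities.
\<close>
lemma dickson:
  fixes S :: "'x::finite monomial set"
  shows "\<exists>B. finite B \<and> B \<subseteq> S \<and> S \<subseteq> cone B"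
proof -
  define B where "B = {b \<in> S. \<forall>s\<in>S. mon_dvd s b \<longrightarrow> s = b}"
  have "finite B"
  proof (rule ccontr)
    assume "infinite B"
    then obtain f :: "nat \<Rightarrow> 'x monomial" where f: "inj f" "range f \<subseteq> B"
      using infinite_countable_subset by blast
    obtain i j where "i < j" "mon_dvd (f i) (f j)"
      using ex_mon_dvd_in_sequence by blast
    moreover have "f i \<in> S" "f j \<in> B" using f(2) by (auto simp: B_def)
    ultimately have "f i = f j" by (simp add: B_def)
    with f(1) \<open>i < j\<close> show False by (simp add: inj_eq)
  qed
  moreover have "S \<subseteq> cone B"
  proof
    fix s assume s: "s \<in> S"
    define d where "d u = (\<Sum>x\<in>UNIV. lookup u x)" for u :: "'x monomial"
    \<comment> \<open>A divisor of \<open>s\<close> in \<open>S\<close> of least total degree is minimal for divisibility.\<close>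
    obtain b where b: "b \<in> S" "mon_dvd b s"
      and least: "\<And>t. t \<in> S \<Longrightarrow> mon_dvd t s \<Longrightarrow> d b \<le> d t"
      using ex_has_least_nat[of "\<lambda>t. t \<in> S \<and> mon_dvd t s" s d] s
      by (auto simp: mon_dvd_iff_le)
    have "t = b" if "t \<in> S" "mon_dvd t b" for t
    proof (rule ccontr)
      assume "t \<noteq> b"
      then obtain x where "lookup t x \<noteq> lookup b x"
        by (meson poly_mapping_eqI)
      with \<open>mon_dvd t b\<close> have "d t < d b"
        unfolding d_def mon_dvd_iff_le
        by (intro sum_strict_mono_ex1) (auto intro: le_neq_implies_less)
      moreover have "mon_dvd t s"
        using \<open>mon_dvd t b\<close> b(2) by (auto simp: mon_dvd_iff_le intro: order_trans)
      ultimately show False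
        using least[of t] \<open>t \<in> S\<close> by simp
    qed
    with b show "s \<in> cone B"
      by (auto simp: in_cone_iff B_def)
  qed
  ultimately show ?thesis
    unfolding B_def by blast
qed

section \<open>Involutive sets of monomials\<close>

lemma involutive_cone_subset_cone: "involutive_cone L U \<subseteq> cone U"
  by (auto simp: involutive_cone_def inv_multiples_def cone_def)

lemma
  assumes "involutive_division L" "finite U" "u \<in> U"
  shows mon_submonoid_multipliers: "mon_submonoid (L u U)"
    and multipliers_subset: "v \<in> U \<Longrightarrow> v \<in> inv_multiples L u U \<Longrightarrow> L v U \<subseteq> L u U"
    and multipliers_antimono: "V \<subseteq> U \<Longrightarrow> u \<in> V \<Longrightarrow> L u U \<subseteq> L u V"
proof -
  note ax = assms(1)[unfolded involutive_division_def, THEN spec[of _ U], THEN mp[OF _ assms(2)]]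
  show "mon_submonoid (L u U)"
    using ax[THEN conjunct1] assms(3) by blast
  show "v \<in> U \<Longrightarrow> v \<in> inv_multiples L u U \<Longrightarrow> L v U \<subseteq> L u U"
    using ax[THEN conjunct2, THEN conjunct2, THEN conjunct2, THEN conjunct1] assms(3) by blast
  show "V \<subseteq> U \<Longrightarrow> u \<in> V \<Longrightarrow> L u U \<subseteq> L u V"
    using ax[THEN conjunct2, THEN conjunct2, THEN conjunct2, THEN conjunct2] by blast
qed

lemma inv_multiples_trans:
  assumes L: "involutive_division L" "finite U" "u \<in> U" "v \<in> U"
    and v: "v \<in> inv_multiples L u U"
  shows "inv_multiples L v U \<subseteq> inv_multiples L u U"
proof -
  have sub: "L v U \<subseteq> L u U" and monoid: "mon_submonoid (L u U)"
    using multipliers_subset[OF L(1,2,3,4) v] mon_submonoid_multipliers[OF L(1,2,3)] .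
  from v obtain t where t: "v = u + t" "t \<in> L u U"
    unfolding inv_multiples_def by blast
  have "v + s \<in> inv_multiples L u U" if "s \<in> L v U" for s
  proof -
    have "t + s \<in> L u U"
      using t(2) that sub monoid by (auto simp: mon_submonoid_def)
    then show ?thesis
      unfolding inv_multiples_def t(1) by (auto simp: add.assoc)
  qed
  then show ?thesis
    unfolding inv_multiples_def by blast
qed

lemma inv_multiples_antimono:
  assumes "involutive_division L" "finite U" "V \<subseteq> U" "u \<in> V"
  shows "inv_multiples L u U \<subseteq> inv_multiples L u V"
  using multipliers_antimono[OF assms(1,2) _ assms(3,4)] assms(3,4)
  unfolding inv_multiples_def by blast

lemma self_in_inv_multiples:
  assumes "involutive_division L" "finite U" "u \<in> U"
  shows "u \<in> inv_multiples L u U"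
  using mon_submonoid_multipliers[OF assms] unfolding inv_multiples_def mon_submonoid_def
  by force

text \<open>
  The cone of a finite \<open>L\<close>-involutive set is also spanned by an \<open>L\<close>-autoreduced one: any
  \<open>L\<close>-redundant element may be deleted, so a subset of least cardinality has none.
\<close>
lemma autoreduced_involutive_subset:
  assumes L: "involutive_division L" and V: "finite V" "involutive_set L V"
  shows "\<exists>W\<subseteq>V. autoreduced_monomials L W \<and> involutive_cone L W = cone V"
proof -
  let ?P = "\<lambda>W. W \<subseteq> V \<and> involutive_cone L W = cone V"
  have "?P V" using V(2) by (simp add: involutive_set_def)
  then obtain W where W: "?P W" and least: "\<And>W'. ?P W' \<Longrightarrow> card W \<le> card W'"
    using ex_has_least_nat[of ?P V card] by blast
  have fin: "finite W" using W V(1) finite_subset by blast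
  have "autoreduced_monomials L W"
    unfolding autoreduced_monomials_def
  proof (intro ballI impI notI)
    fix u v assume u: "u \<in> W" and v: "v \<in> W" "v \<noteq> u" and dvd: "u \<in> inv_multiples L v W"
    have "cone V \<subseteq> involutive_cone L (W - {u})"
    proof
      fix w assume "w \<in> cone V"
      with W obtain t where t: "t \<in> W" "w \<in> inv_multiples L t W"
        by (auto simp: involutive_cone_def)
      obtain t' where t': "t' \<in> W - {u}" "w \<in> inv_multiples L t' W"
        using t u v inv_multiples_trans[OF L fin v(1) u dvd] by (cases "t = u") blast+
      then have "w \<in> inv_multiples L t' (W - {u})"
        using inv_multiples_antimono[OF L fin, of "W - {u}" t'] by blast
      with t'(1) show "w \<in> involutive_cone L (W - {u})"
        unfolding involutive_cone_def by blast
    qed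
    moreover have "cone (W - {u}) \<subseteq> cone V"
      using W by (auto simp: cone_def)
    ultimately have "?P (W - {u})"
      using W involutive_cone_subset_cone[of L "W - {u}"] by blast
    then show False
      using least[of "W - {u}"] card_Diff1_less[OF fin u] by simp
  qed
  with W show ?thesis by blast
qed

section \<open>Leading monomials\<close>

lemma lookup_times_mon_poly:
  fixes p :: "('x, 'k::field_char_0) mpolynomial"
  shows "lookup (p * mon_poly v) (u + v) = lookup p u"
proof -
  have "(\<Sum>q. lookup (mon_poly v :: ('x, 'k) mpolynomial) q when u + v = l + q) = (1 when l = u)" for l
  proof -
    have "(\<Sum>q. lookup (mon_poly v :: ('x, 'k) mpolynomial) q when u + v = l + q)
        = (\<Sum>q. (1 when l = u) when q = v)"
      by (rule Sum_any.cong) (auto simp: mon_poly_def lookup_single when_def)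
    also have "\<dots> = (1 when l = u)" by (rule Sum_any_when_equal)
    finally show ?thesis .
  qed
  then show ?thesis
    by (simp add: lookup_mult mult_when)
qed

lemma keys_times_mon_poly: "keys (p * mon_poly v) \<subseteq> (\<lambda>u. u + v) ` keys p"
  using keys_mult[of p "mon_poly v"] by (auto simp: mon_poly_def)

lemma lookup_scale: "lookup (Poly_Mapping.single 0 c * p) u = c * lookup p u"
  for p :: "('x, 'k::field_char_0) mpolynomial"
  unfolding mult_map_scale_conv_mult[symmetric] by (simp add: Poly_Mapping.map.rep_eq when_def)

lemma keys_scale: "keys (Poly_Mapping.single 0 c * p) \<subseteq> keys p"
  for p :: "('x, 'k::field_char_0) mpolynomial"
  by (auto simp: in_keys_iff lookup_scale)

locale monomial_order =
  fixes gt :: "'x::{finite,linorder} monomial \<Rightarrow> 'x monomial \<Rightarrow> bool"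
  assumes admissible: "admissible_order gt"
begin

lemma irrefl: "\<not> gt u u"
  and trans: "gt u v \<Longrightarrow> gt v w \<Longrightarrow> gt u w"
  and total: "u \<noteq> v \<Longrightarrow> gt u v \<or> gt v u"
  and add_right: "gt u v \<Longrightarrow> gt (u + w) (v + w)"
  using admissible unfolding admissible_order_def by blast+

lemma mon_dvd_imp_not_gt:
  assumes "mon_dvd u v" shows "\<not> gt u v"
proof -
  obtain t where t: "v = u + t" using assms unfolding mon_dvd_def by blast
  have "gt v u" if "t \<noteq> 0"
    using that admissible add_right[of t 0 u] t
    by (auto simp: admissible_order_def add.commute)
  with t irrefl trans show ?thesis by (metis add.right_neutral)
qed

text \<open>
  An infinite descending chain would contain a monomial dividing a later, hence smaller, one.
\<close>
lemma wf_gt: "wf {(v, u). gt u v}"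
proof (rule ccontr)
  assume "\<not> wf {(v, u). gt u v}"
  then obtain f where step: "\<And>i. gt (f i) (f (Suc i))"
    unfolding wf_iff_no_infinite_down_chain by auto
  have "gt (f i) (f j)" if "i < j" for i j
    using that by (induction rule: less_Suc_induct) (auto intro: step trans)
  then show False
    using ex_mon_dvd_in_sequence[of f] mon_dvd_imp_not_gt by blast
qed

lemma ex_greatest:
  assumes "finite A" "A \<noteq> {}"
  shows "\<exists>u\<in>A. \<forall>v\<in>A. v \<noteq> u \<longrightarrow> gt u v"
  using assms
proof (induction rule: finite_ne_induct)
  case (insert a A)
  then obtain u where u: "u \<in> A" "\<forall>v\<in>A. v \<noteq> u \<longrightarrow> gt u v" by blast
  show ?case
  proof (cases "gt a u")
    case True
    with u have "\<forall>v\<in>insert a A. v \<noteq> a \<longrightarrow> gt a v"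
      by (metis insertE trans)
    then show ?thesis by blast
  next
    case False
    with u have "\<forall>v\<in>insert a A. v \<noteq> u \<longrightarrow> gt u v"
      by (metis insertE total)
    with u show ?thesis by blast
  qed
qed simp

lemma lm_eqI:
  assumes "u \<in> keys p" "\<And>v. v \<in> keys p \<Longrightarrow> v \<noteq> u \<Longrightarrow> gt u v"
  shows "lm gt p = u"
  unfolding lm_def
proof (rule the_equality)
  show "u \<in> keys p \<and> (\<forall>v\<in>keys p. v \<noteq> u \<longrightarrow> gt u v)"
    using assms by blast
  show "v = u" if v: "v \<in> keys p \<and> (\<forall>w\<in>keys p. w \<noteq> v \<longrightarrow> gt v w)" for v
  proof (rule ccontr)
    assume "v \<noteq> u"
    then have "gt u v" "gt v u" using assms v by auto
    then show False using irrefl trans by blast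
  qed
qed

lemma
  assumes "p \<noteq> 0"
  shows lm_in_keys: "lm gt p \<in> keys p"
    and gt_lm: "v \<in> keys p \<Longrightarrow> v \<noteq> lm gt p \<Longrightarrow> gt (lm gt p) v"
proof -
  obtain u where "u \<in> keys p" "\<forall>v\<in>keys p. v \<noteq> u \<longrightarrow> gt u v"
    using ex_greatest[of "keys p"] assms by auto
  then show "lm gt p \<in> keys p" "v \<in> keys p \<Longrightarrow> v \<noteq> lm gt p \<Longrightarrow> gt (lm gt p) v"
    using lm_eqI[of u p] by auto
qed

lemma lm_times_mon_poly:
  assumes "p \<noteq> 0"
  shows "lm gt (p * mon_poly v) = lm gt p + v"
    and "lc gt (p * mon_poly v) = lc gt p"
    and "p * mon_poly v \<noteq> 0"
proof -
  have key: "lm gt p + v \<in> keys (p * mon_poly v)"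
    using lm_in_keys[OF assms] by (simp add: in_keys_iff lookup_times_mon_poly)
  show lm: "lm gt (p * mon_poly v) = lm gt p + v"
  proof (rule lm_eqI[OF key])
    fix w assume w: "w \<in> keys (p * mon_poly v)" "w \<noteq> lm gt p + v"
    then obtain u where "u \<in> keys p" "w = u + v"
      using keys_times_mon_poly by blast
    with w(2) gt_lm[OF assms] add_right show "gt (lm gt p + v) w" by blast
  qed
  show "lc gt (p * mon_poly v) = lc gt p"
    unfolding lc_def lm by (rule lookup_times_mon_poly)
  show "p * mon_poly v \<noteq> 0" using key by auto
qed

text \<open>
  Cancelling leading terms, the elementary step behind both the remainders and the involutive
  reductions below.
\<close>
lemma keys_cancel_lm:
  assumes "p \<noteq> 0" "f \<noteq> 0" "lm gt f = lm gt p"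
    and u: "u \<in> keys (p - Poly_Mapping.single 0 (lookup p (lm gt p) / lc gt f) * f)"
  shows "gt (lm gt p) u"
proof -
  have "lc gt f \<noteq> 0"
    using lm_in_keys[OF assms(2)] by (simp add: lc_def in_keys_iff)
  then have "u \<noteq> lm gt p"
    using u assms(3) by (auto simp: in_keys_iff lookup_minus lookup_scale lc_def)
  moreover have "u \<in> keys p \<or> u \<in> keys f"
    using u by (auto simp: in_keys_iff lookup_minus lookup_scale)
  ultimately show ?thesis
    using gt_lm[of p u] gt_lm[of f u] assms by auto
qed

end

section \<open>Remainders and reduction modulo an ideal\<close>

interpretation ideals: module "(*) :: 'a::comm_ring_1 \<Rightarrow> 'a \<Rightarrow> 'a"
  by unfold_locales (simp_all add: algebra_simps)

lemma poly_eq_sum_monomials: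
  "p = (\<Sum>u\<in>keys p. Poly_Mapping.single 0 (lookup p u) * mon_poly u)"
  for p :: "('x, 'k::field_char_0) mpolynomial"
proof (rule poly_mapping_eqI)
  fix v
  have "lookup (\<Sum>u\<in>keys p. Poly_Mapping.single 0 (lookup p u) * mon_poly u) v
      = (\<Sum>u\<in>keys p. if u = v then lookup p u else 0)"
    unfolding lookup_sum lookup_scale mon_poly_def
    by (intro sum.cong) (auto simp: lookup_single when_def)
  then show "lookup p v = lookup (\<Sum>u\<in>keys p. Poly_Mapping.single 0 (lookup p u) * mon_poly u) v"
    by (simp add: in_keys_iff)
qed

definition leading_monomials ::
  "('x monomial \<Rightarrow> 'x monomial \<Rightarrow> bool) \<Rightarrow> ('x, 'k::field_char_0) mpolynomial set \<Rightarrow> 'x monomial set" where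
  "leading_monomials gt I = lm gt ` (I - {0})"

context monomial_order
begin

text \<open>
  Here \<open>q\<close> is the remainder of the monomial \<open>w\<close> modulo the ideal \<open>I\<close>. If \<open>w\<close> is the leading monomial
  of a monic \<open>f \<in> I\<close>, then \<open>w\<close> is congruent to \<open>w - f\<close>, a combination of smaller monomials, whose
  remainders are available by well-founded induction.
\<close>
lemma monomial_remainder:
  fixes I :: "('x, 'k::field_char_0) mpolynomial set"
  assumes I: "ideals.subspace I"
  shows "\<exists>q. mon_poly w - q \<in> I \<and> keys q \<inter> leading_monomials gt I = {} \<and>
    (\<forall>u\<in>keys q. u = w \<or> gt w u)"
proof (induction w rule: wf_induct_rule[OF wf_gt])
  case (1 w)
  show ?case
  proof (cases "w \<in> leading_monomials gt I")
    case False
    then show ?thesis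
      by (intro exI[of _ "mon_poly w"]) (auto simp: mon_poly_def ideals.subspace_0[OF I])
  next
    case True
    then obtain f where f: "f \<in> I" "f \<noteq> 0" "lm gt f = w"
      by (auto simp: leading_monomials_def)
    have lm_w: "lm gt (mon_poly w :: ('x, 'k) mpolynomial) = w"
      by (rule lm_eqI) (auto simp: mon_poly_def)
    define p where "p = mon_poly w - Poly_Mapping.single 0 (1 / lc gt f) * f"
    have p_less: "gt w u" if "u \<in> keys p" for u
      using keys_cancel_lm[of "mon_poly w" f u] that f lm_w
      by (simp add: p_def mon_poly_def flip: keys_eq_empty)
    with 1 have "\<forall>u\<in>keys p. \<exists>q. mon_poly u - q \<in> I \<and> keys q \<inter> leading_monomials gt I = {} \<and>
        (\<forall>v\<in>keys q. v = u \<or> gt u v)"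
      by simp
    then obtain r where r: "\<And>u. u \<in> keys p \<Longrightarrow> mon_poly u - r u \<in> I"
      "\<And>u. u \<in> keys p \<Longrightarrow> keys (r u) \<inter> leading_monomials gt I = {}"
      "\<And>u v. u \<in> keys p \<Longrightarrow> v \<in> keys (r u) \<Longrightarrow> v = u \<or> gt u v"
      by metis
    define q where "q = (\<Sum>u\<in>keys p. Poly_Mapping.single 0 (lookup p u) * r u)"
    have keys_q: "\<exists>u\<in>keys p. v \<in> keys (r u)" if "v \<in> keys q" for v
      using that keys_sum[of "\<lambda>u. Poly_Mapping.single 0 (lookup p u) * r u" "keys p"] keys_scale
      unfolding q_def by blast
    have "p - q = (\<Sum>u\<in>keys p. Poly_Mapping.single 0 (lookup p u) * (mon_poly u - r u))"
      unfolding q_def right_diff_distrib sum_subtractf poly_eq_sum_monomials[of p, symmetric] ..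
    also have "\<dots> \<in> I"
      by (intro ideals.subspace_sum[OF I] ideals.subspace_scale[OF I] r(1))
    finally have "(p - q) + Poly_Mapping.single 0 (1 / lc gt f) * f \<in> I"
      by (intro ideals.subspace_add[OF I] ideals.subspace_scale[OF I] f(1))
    then have "mon_poly w - q \<in> I"
      by (simp add: p_def)
    with keys_q r(2,3) p_less trans show ?thesis
      by (intro exI[of _ q]) blast
  qed
qed

lemma ex_reduced_element:
  fixes I :: "('x, 'k::field_char_0) mpolynomial set"
  assumes I: "ideals.subspace I" and w: "w \<in> leading_monomials gt I"
  shows "\<exists>g\<in>I. g \<noteq> 0 \<and> lm gt g = w \<and> (\<forall>u\<in>keys g. u \<noteq> w \<longrightarrow> u \<notin> leading_monomials gt I)"
proof -
  obtain q where q: "mon_poly w - q \<in> I" "keys q \<inter> leading_monomials gt I = {}"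
    "\<forall>u\<in>keys q. u = w \<or> gt w u"
    using monomial_remainder[OF I] by blast
  let ?g = "mon_poly w - q"
  have "lookup q w = 0"
    using q(2) w by (auto simp: in_keys_iff)
  then have key: "w \<in> keys ?g"
    by (simp add: in_keys_iff lookup_minus mon_poly_def)
  have keys: "u \<in> keys q" if "u \<in> keys ?g" "u \<noteq> w" for u
    using that by (auto simp: in_keys_iff lookup_minus mon_poly_def lookup_single)
  have "lm gt ?g = w"
    using keys q(3) by (intro lm_eqI key) blast
  moreover have "?g \<noteq> 0" using key by auto
  ultimately show ?thesis using q(1,2) keys by (intro bexI[of _ ?g]) auto
qed

lemma leading_monomials_add:
  fixes I :: "('x, 'k::field_char_0) mpolynomial set"
  assumes "ideals.subspace I" "u \<in> leading_monomials gt I"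
  shows "u + v \<in> leading_monomials gt I"
proof -
  obtain f where f: "f \<in> I" "f \<noteq> 0" "lm gt f = u"
    using assms(2) by (auto simp: leading_monomials_def)
  have "f * mon_poly v \<in> I"
    using ideals.subspace_scale[OF assms(1) f(1), of "mon_poly v"] by (simp add: mult.commute)
  with f lm_times_mon_poly[OF f(2), of v] show ?thesis
    unfolding leading_monomials_def by force
qed

lemma finite_leading_monomial_basis:
  fixes I :: "('x, 'k::field_char_0) mpolynomial set"
  assumes "ideals.subspace I"
  shows "\<exists>B. finite B \<and> cone B = leading_monomials gt I"
proof -
  obtain B where B: "finite B" "B \<subseteq> leading_monomials gt I" "leading_monomials gt I \<subseteq> cone B"
    using dickson by blast
  have "cone B \<subseteq> leading_monomials gt I"
    using B(2) leading_monomials_add[OF assms] by (auto simp: cone_def)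
  with B show ?thesis by blast
qed

lemma red_steps_diff_in_ideal:
  assumes "(\<lambda>p q. \<exists>g\<in>G. red_step L gt G g p q)\<^sup>*\<^sup>* p h"
  shows "p - h \<in> ideal_gen G"
  using assms
proof (induction rule: rtranclp_induct)
  case base
  show ?case by (simp add: ideal_gen_def ideals.span_zero)
next
  case (step q h)
  then obtain g a v where g: "g \<in> G" "h = q - a * (g * mon_poly v)"
    by (auto simp: red_step_def)
  have "(a * mon_poly v) * g \<in> ideal_gen G"
    using g(1) by (simp add: ideal_gen_def ideals.span_base ideals.span_scale)
  with step.IH have "(p - q) + (a * mon_poly v) * g \<in> ideal_gen G"
    by (simp add: ideal_gen_def ideals.span_add)
  also have "(a * mon_poly v) * g = a * (g * mon_poly v)"
    by (simp only: mult.assoc mult.commute[of g "mon_poly v"])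
  finally show ?case
    unfolding g(2) by (simp only: diff_diff_eq2 add_diff_eq diff_add_eq)
qed

text \<open>
  A nonzero \<open>p \<in> I\<close> can be reduced at its leading monomial, so well-founded induction on that
  monomial applies.
\<close>
lemma reduces_to_zero:
  fixes I :: "('x, 'k::field_char_0) mpolynomial set"
  assumes I: "ideals.subspace I" and G: "G \<subseteq> I" "0 \<notin> G"
    and cone: "leading_monomials gt I \<subseteq> involutive_cone L (lm gt ` G)"
    and p: "p \<in> I"
  shows "(\<lambda>p q. \<exists>g\<in>G. red_step L gt G g p q)\<^sup>*\<^sup>* p 0"
    (is "?red\<^sup>*\<^sup>* p 0")
proof -
  have "?red\<^sup>*\<^sup>* p 0" if "p \<in> I" "p \<noteq> 0" "lm gt p = w" for p w
    using that
  proof (induction w arbitrary: p rule: wf_induct_rule[OF wf_gt])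
    case (1 w)
    from 1(2-4) cone have "w \<in> involutive_cone L (lm gt ` G)"
      by (auto simp: leading_monomials_def)
    then obtain g v where g: "g \<in> G" and w: "w = lm gt g + v" and v: "v \<in> L (lm gt g) (lm gt ` G)"
      by (auto simp: involutive_cone_def inv_multiples_def)
    have g0: "g \<noteq> 0" using g G(2) by blast
    define q where "q = p - Poly_Mapping.single 0 (lookup p w / lc gt g) * (g * mon_poly v)"
    have "w \<in> keys p" using lm_in_keys[OF 1(3)] 1(4) by simp
    then have step: "red_step L gt G g p q"
      unfolding red_step_def q_def using w v
      by (intro exI[of _ w] exI[of _ v] conjI refl)
    have "Poly_Mapping.single 0 (lookup p w / lc gt g) * mon_poly v * g \<in> I"
      using g G(1) by (intro ideals.subspace_scale[OF I]) blast
    then have qI: "q \<in> I"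
      unfolding q_def by (intro ideals.subspace_diff[OF I 1(2)]) (simp only: mult.assoc mult.commute[of g "mon_poly v"])
    have less: "gt w u" if "u \<in> keys q" for u
      using keys_cancel_lm[OF 1(3) lm_times_mon_poly(3)[OF g0], of v u] that
      by (simp add: q_def lm_times_mon_poly[OF g0] w 1(4))
    have "?red\<^sup>*\<^sup>* q 0"
    proof (cases "q = 0")
      case False
      then show ?thesis using 1(1) less[OF lm_in_keys[OF False]] qI by blast
    qed simp
    moreover have "\<exists>g\<in>G. red_step L gt G g p q" using step g by blast
    ultimately show ?case by (rule converse_rtranclp_into_rtranclp[rotated])
  qed
  with p show ?thesis by (cases "p = 0") auto
qed

lemma normal_form_in_ideal_eq_zero:
  fixes I :: "('x, 'k::field_char_0) mpolynomial set"
  assumes "leading_monomials gt I \<subseteq> involutive_cone L (lm gt ` G)"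
    and "h \<in> I" "in_normal_form L gt G h"
  shows "h = 0"
proof (rule ccontr)
  assume h: "h \<noteq> 0"
  with assms(1,2) have "lm gt h \<in> involutive_cone L (lm gt ` G)"
    by (auto simp: leading_monomials_def)
  with lm_in_keys[OF h] have "\<exists>g\<in>G. reducible L gt G g h"
    unfolding reducible_def involutive_cone_def inv_multiples_def by blast
  with assms(3) show False by (simp add: in_normal_form_def)
qed

end

section \<open>Existence of involutive bases\<close>

text \<open>
  Reductions modulo \<open>G\<close> stay inside \<open>I\<close>, where 0 is the only \<open>L\<close>-normal form, so the strategy behind
  \<open>NF\<close> does not matter. What has to be checked is that \<open>NF\<close> is constrained at all, that is, that a
  normal form exists; this is where reduction at the leading monomial is used.
\<close>
lemma (in monomial_order) involutive_basisI:
  fixes I :: "('x, 'k::field_char_0) mpolynomial set"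
  assumes NF: "normal_form_algorithm L gt NF"
    and I: "ideals.subspace I" and G: "G \<subseteq> I" "autoreduced L gt G"
    and cone: "leading_monomials gt I \<subseteq> involutive_cone L (lm gt ` G)"
  shows "involutive_basis L gt NF I G"
proof -
  have G': "finite G" "0 \<notin> G" using G(2) by (auto simp: autoreduced_def)
  note red0 = reduces_to_zero[OF I G(1) G'(2) cone]
  have gen: "ideal_gen G = I"
  proof
    show "ideal_gen G \<subseteq> I"
      unfolding ideal_gen_def by (rule ideals.span_minimal[OF G(1) I])
    show "I \<subseteq> ideal_gen G"
      using red_steps_diff_in_ideal[OF red0] by auto
  qed
  have "NF (g * mon_poly u) G = 0" if "g \<in> G" for g u
  proof -
    have gu: "g * mon_poly u \<in> I"
      using ideals.subspace_scale[OF I, of g "mon_poly u"] that G(1) by (auto simp: mult.commute)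
    have "normal_form_of L gt G (g * mon_poly u) 0"
      using red0[OF gu] by (simp add: normal_form_of_def in_normal_form_def reducible_def)
    with NF G' have nf: "normal_form_of L gt G (g * mon_poly u) (NF (g * mon_poly u) G)"
      unfolding normal_form_algorithm_def by blast
    then have "g * mon_poly u - NF (g * mon_poly u) G \<in> I"
      using red_steps_diff_in_ideal gen unfolding normal_form_of_def by blast
    from ideals.subspace_diff[OF I gu this] have "NF (g * mon_poly u) G \<in> I"
      by simp
    with nf cone show ?thesis
      using normal_form_in_ideal_eq_zero unfolding normal_form_of_def by blast
  qed
  with G G' gen show ?thesis unfolding involutive_basis_def by blast
qed

theorem proposition7p5:
  fixes L :: "'x::{finite,linorder} division"
    and gt :: "'x monomial \<Rightarrow> 'x monomial \<Rightarrow> bool"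
    and NF :: "('x, 'k::field_char_0) mpolynomial \<Rightarrow> ('x, 'k) mpolynomial set \<Rightarrow> ('x, 'k) mpolynomial"
    and F :: "('x, 'k) mpolynomial set"
  assumes "involutive_division L"
    and "noetherian_division L"
    and "admissible_order gt"
    and "\<And>i j. i < j \<Longrightarrow> gt (var i) (var j)"
    and "normal_form_algorithm L gt NF"
    and "finite F"
  shows "\<exists>G. involutive_basis L gt NF (ideal_gen F) G"
proof -
  interpret monomial_order gt by unfold_locales (rule assms(3))
  let ?I = "ideal_gen F" and ?M = "leading_monomials gt (ideal_gen F)"
  have I: "ideals.subspace ?I" unfolding ideal_gen_def by (rule ideals.subspace_span)
  obtain B where B: "finite B" "cone B = ?M"
    using finite_leading_monomial_basis[OF I] by blast
  obtain V where V: "finite V" "involutive_set L V" "cone V = ?M"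
    using assms(2) B unfolding noetherian_division_def by metis
  obtain W where W: "W \<subseteq> V" "autoreduced_monomials L W" "involutive_cone L W = ?M"
    using autoreduced_involutive_subset[OF assms(1) V(1,2)] V(3) by auto
  have fin: "finite W" using W(1) V(1) finite_subset by blast
  have "W \<subseteq> ?M"
    using self_in_inv_multiples[OF assms(1) fin] W(3) by (auto simp: involutive_cone_def)
  then have "\<forall>w\<in>W. \<exists>g\<in>?I. g \<noteq> 0 \<and> lm gt g = w \<and> (\<forall>u\<in>keys g. u \<noteq> w \<longrightarrow> u \<notin> ?M)"
    using ex_reduced_element[OF I] by blast
  then obtain g where g: "\<And>w. w \<in> W \<Longrightarrow> g w \<in> ?I" "\<And>w. w \<in> W \<Longrightarrow> g w \<noteq> 0"
    "\<And>w. w \<in> W \<Longrightarrow> lm gt (g w) = w"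
    "\<And>w u. w \<in> W \<Longrightarrow> u \<in> keys (g w) \<Longrightarrow> u \<noteq> w \<Longrightarrow> u \<notin> ?M"
    by metis
  have lm_G: "lm gt ` (g ` W) = W"
    using g(3) by (force simp: image_image)
  have "autoreduced L gt (g ` W)"
    unfolding autoreduced_def lm_G
  proof (intro conjI)
    show "inj_on (lm gt) (g ` W)"
      by (rule inj_onI) (auto simp: g(3))
    show "0 \<notin> g ` W" using g(2) by fastforce
    show "\<forall>h\<in>g ` W. \<forall>u\<in>keys h. u \<noteq> lm gt h \<longrightarrow> u \<notin> involutive_cone L W"
      using g(3,4) W(3) by auto
  qed (use fin W(2) in auto)
  then have "involutive_basis L gt NF ?I (g ` W)"
    using g(1) by (intro involutive_basisI[OF assms(5) I]) (auto simp: lm_G W(3))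
  then show ?thesis by blast
qed

end
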